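(* Let $G$ be a group. Then the defect $\delta_G$ of $G$ is equal to $\delta_\ell(\mu)$ for some finitely additive probability mean $\mu$ on $G$. Moreover, $\delta_G$ equals either $0$ or $1$, and is $0$ precisely when $G$ is amenable.
   Context: A finitely additive probability mean on a group $G$ is a function $\mu\colon\mathcal{P}(G)\to[0,1]$ with $\mu(G)=1$ and $\mu(A\sqcup B)=\mu(A)+\mu(B)$ for all disjoint $A,B\subseteq G$. Its left defect is $\delta_\ell(\mu)=\sup\{|\mu(gA)-\mu(A)|: g\in G, A\subseteq G\}\in[0,1]$. The defect of $G$ is $\delta_G=\inf_\mu \delta_\ell(\mu)$, the infimum being over all finitely additive probability means $\mu$ on $G$. A group $G$ is amenable if it admits a finitely additive probability mean $\mu$ with $\mu(gA)=\mu(A)$ for all $g\in G$, $A\subseteq G$. *)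

theory Defs
  imports Complex_Main "HOL-Algebra.Coset"
begin

(* Means are total functions on 'a set; only their values on subsets of carrier G are
   constrained, and only those values enter the definitions below. *)
definition fa_mean :: "('a, 'b) monoid_scheme \<Rightarrow> ('a set \<Rightarrow> real) \<Rightarrow> bool" where
  "fa_mean G \<mu> \<longleftrightarrow>
     (\<forall>A \<subseteq> carrier G. 0 \<le> \<mu> A \<and> \<mu> A \<le> 1) \<and>
     \<mu> (carrier G) = 1 \<and>
     (\<forall>A \<subseteq> carrier G. \<forall>B \<subseteq> carrier G. A \<inter> B = {} \<longrightarrow> \<mu> (A \<union> B) = \<mu> A + \<mu> B)"

(* For a mean on a group, the set is nonempty and bounded by 1, so this real Sup is the
   genuine supremum. *)
definition left_defect :: "('a, 'b) monoid_scheme \<Rightarrow> ('a set \<Rightarrow> real) \<Rightarrow> real" where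
  "left_defect G \<mu> =
     Sup {\<bar>\<mu> (g <#\<^bsub>G\<^esub> A) - \<mu> A\<bar> | g A. g \<in> carrier G \<and> A \<subseteq> carrier G}"

(* Point masses are means and left_defect is nonnegative on means, so for a group this
   real Inf is the genuine infimum. *)
definition group_defect :: "('a, 'b) monoid_scheme \<Rightarrow> real" where
  "group_defect G = Inf {left_defect G \<mu> | \<mu>. fa_mean G \<mu>}"

definition amenable :: "('a, 'b) monoid_scheme \<Rightarrow> bool" where
  "amenable G \<longleftrightarrow>
     (\<exists>\<mu>. fa_mean G \<mu> \<and> (\<forall>g \<in> carrier G. \<forall>A \<subseteq> carrier G. \<mu> (g <#\<^bsub>G\<^esub> A) = \<mu> A))"

end

(* The infimum is attained because the means form a compact subset of the product of unit
   intervals and the defect is lower semicontinuous.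

   For the dichotomy, suppose a mean mu has defect d < 1. Think of square roots of means as unit
   vectors in an L^2 space. Bounding sqrt (x y) below by min x y shows that sqrt mu has inner
   product at least 1 - d > 0 with each of its translates. Let C be the largest c such that some
   mean nu has affinity (inner product of square roots) at least c with every translate of mu.
   The condition on nu is translation invariant. If nu1 and nu2 are both nearly optimal, then so
   is the midpoint of their square roots; unless nu1 and nu2 are close this midpoint is much
   shorter than 1, and normalising it would exceed C. So a nearly optimal mean is uniformly close
   to its translates, and means of arbitrarily small defect exist.

   For finitely additive measures the square of the midpoint vector is the infimum, over finite
   partitions, of the sums of the superadditive set function ((sqrt nu1 + sqrt nu2) / 2)^2. *)

theory Submission
  imports Defs "HOL-Analysis.Function_Topology" "HOL-Analysis.L2_Norm"
begin

section \<open>Finitely additive and superadditive set functions\<close>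

definition fin_additive :: "'a set \<Rightarrow> ('a set \<Rightarrow> real) \<Rightarrow> bool" where
  "fin_additive X \<nu> \<longleftrightarrow> (\<forall>A\<subseteq>X. 0 \<le> \<nu> A) \<and>
     (\<forall>A\<subseteq>X. \<forall>B\<subseteq>X. A \<inter> B = {} \<longrightarrow> \<nu> (A \<union> B) = \<nu> A + \<nu> B)"

definition superadditive :: "'a set \<Rightarrow> ('a set \<Rightarrow> real) \<Rightarrow> bool" where
  "superadditive X \<Phi> \<longleftrightarrow> (\<forall>A\<subseteq>X. 0 \<le> \<Phi> A) \<and>
     (\<forall>A\<subseteq>X. \<forall>B\<subseteq>X. A \<inter> B = {} \<longrightarrow> \<Phi> A + \<Phi> B \<le> \<Phi> (A \<union> B))"

lemma fin_additive_nonneg: "fin_additive X \<nu> \<Longrightarrow> A \<subseteq> X \<Longrightarrow> 0 \<le> \<nu> A"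
  by (simp add: fin_additive_def)

lemma superadditive_nonneg: "superadditive X \<Phi> \<Longrightarrow> A \<subseteq> X \<Longrightarrow> 0 \<le> \<Phi> A"
  by (simp add: superadditive_def)

lemma superadditive_Un:
  "superadditive X \<Phi> \<Longrightarrow> A \<subseteq> X \<Longrightarrow> B \<subseteq> X \<Longrightarrow> A \<inter> B = {} \<Longrightarrow> \<Phi> A + \<Phi> B \<le> \<Phi> (A \<union> B)"
  by (simp add: superadditive_def)

lemma fin_additive_Un:
  "fin_additive X \<nu> \<Longrightarrow> A \<subseteq> X \<Longrightarrow> B \<subseteq> X \<Longrightarrow> A \<inter> B = {} \<Longrightarrow> \<nu> (A \<union> B) = \<nu> A + \<nu> B"
  by (simp add: fin_additive_def)

lemma fin_additive_empty: "fin_additive X \<nu> \<Longrightarrow> \<nu> {} = 0"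
  using fin_additive_Un[of X \<nu> "{}" "{}"] by simp

lemma fin_additive_mono:
  assumes "fin_additive X \<nu>" "A \<subseteq> B" "B \<subseteq> X" shows "\<nu> A \<le> \<nu> B"
proof -
  have "\<nu> (A \<union> (B - A)) = \<nu> A + \<nu> (B - A)"
    using assms(2,3) by (intro fin_additive_Un[OF assms(1)]) auto
  moreover have "A \<union> (B - A) = B" using assms by auto
  moreover have "0 \<le> \<nu> (B - A)" using assms by (intro fin_additive_nonneg[OF assms(1)]) auto
  ultimately show ?thesis by simp
qed

lemma fin_additive_sum_fibres:
  assumes "fin_additive X \<nu>" "A \<subseteq> X" "finite I"
  shows "(\<Sum>i\<in>I. \<nu> {x \<in> A. p x = i}) = \<nu> {x \<in> A. p x \<in> I}"
  using assms(3)
proof (induction I)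
  case empty
  then show ?case using fin_additive_empty[OF assms(1)] by simp
next
  case (insert i I)
  have "{x \<in> A. p x \<in> insert i I} = {x \<in> A. p x = i} \<union> {x \<in> A. p x \<in> I}" by auto
  also have "\<nu> \<dots> = \<nu> {x \<in> A. p x = i} + \<nu> {x \<in> A. p x \<in> I}"
    using assms insert by (intro fin_additive_Un) auto
  finally show ?case using insert by simp
qed

lemma fin_additive_sum_partition:
  assumes "fin_additive X \<nu>" "A \<subseteq> X" "finite I" "p ` A \<subseteq> I"
  shows "(\<Sum>i\<in>I. \<nu> {x \<in> A. p x = i}) = \<nu> A"
proof -
  have "{x \<in> A. p x \<in> I} = A" using assms(4) by auto
  then show ?thesis using fin_additive_sum_fibres[OF assms(1-3), of p] by simp
qed

section \<open>Finite partitions and additive regularisation\<close>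

text \<open>Each cell of a partition may be refined by a partition of its own;
  \<open>prod_encode\<close> turns the pairs of labels back into natural numbers. The identity is
  kept for every \<open>h\<close>, since it is used both for a superadditive function and for
  \<open>sqrt (\<Phi> A * \<tau> A)\<close>.\<close>

lemma partition_glue:
  fixes p :: "'a \<Rightarrow> nat" and q :: "nat \<Rightarrow> 'a \<Rightarrow> nat"
  assumes "finite I" "p ` A \<subseteq> I" "\<And>i. i \<in> I \<Longrightarrow> finite (J i)"
    and "\<And>i. i \<in> I \<Longrightarrow> q i ` {x \<in> A. p x = i} \<subseteq> J i"
  obtains K :: "nat set" and r where "finite K" "r ` A \<subseteq> K"
    "\<And>h :: 'a set \<Rightarrow> real. (\<Sum>k\<in>K. h {x \<in> A. r x = k})
        = (\<Sum>i\<in>I. \<Sum>j\<in>J i. h {x \<in> {x \<in> A. p x = i}. q i x = j})"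
proof
  define r where "r = (\<lambda>x. prod_encode (p x, q (p x) x))"
  define K where "K = prod_encode ` Sigma I J"
  show "finite K" using assms by (auto simp: K_def)
  show "r ` A \<subseteq> K" using assms by (fastforce simp: K_def r_def)
  fix h :: "'a set \<Rightarrow> real"
  have "(\<Sum>k\<in>K. h {x \<in> A. r x = k}) = (\<Sum>z\<in>Sigma I J. h {x \<in> A. r x = prod_encode z})"
    unfolding K_def by (subst sum.reindex) (auto simp: inj_on_def)
  also have "\<dots> = (\<Sum>(i,j)\<in>Sigma I J. h {x \<in> {x \<in> A. p x = i}. q i x = j})"
    by (rule sum.cong) (auto simp: r_def intro!: arg_cong[where f=h])
  also have "\<dots> = (\<Sum>i\<in>I. \<Sum>j\<in>J i. h {x \<in> {x \<in> A. p x = i}. q i x = j})"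
    using assms by (subst sum.Sigma) auto
  finally show "(\<Sum>k\<in>K. h {x \<in> A. r x = k})
        = (\<Sum>i\<in>I. \<Sum>j\<in>J i. h {x \<in> {x \<in> A. p x = i}. q i x = j})" .
qed

text \<open>A finite partition of \<open>A\<close> is encoded as the fibres of a labelling \<open>p\<close> of \<open>A\<close> by a finite
  set \<open>I\<close> of natural numbers; empty fibres are allowed.\<close>

definition additive_reg :: "('a set \<Rightarrow> real) \<Rightarrow> 'a set \<Rightarrow> real" where
  "additive_reg \<Phi> A =
     Inf {(\<Sum>i\<in>I. \<Phi> {x \<in> A. p x = i}) | (I :: nat set) p. finite I \<and> p ` A \<subseteq> I}"

lemma additive_reg_le:
  fixes p :: "'a \<Rightarrow> nat"
  assumes "superadditive X \<Phi>" "A \<subseteq> X" "finite I" "p ` A \<subseteq> I"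
  shows "additive_reg \<Phi> A \<le> (\<Sum>i\<in>I. \<Phi> {x \<in> A. p x = i})"
  unfolding additive_reg_def
proof (rule cInf_lower)
  show "bdd_below {(\<Sum>i\<in>I. \<Phi> {x \<in> A. p x = i}) | (I :: nat set) p. finite I \<and> p ` A \<subseteq> I}"
    using assms(2)
    by (intro bdd_belowI[of _ 0]) (auto intro!: sum_nonneg superadditive_nonneg[OF assms(1)])
  show "(\<Sum>i\<in>I. \<Phi> {x \<in> A. p x = i})
      \<in> {(\<Sum>i\<in>I. \<Phi> {x \<in> A. p x = i}) | (I :: nat set) p. finite I \<and> p ` A \<subseteq> I}"
    by (rule CollectI, rule exI[of _ I], rule exI[of _ p]) (use assms(3,4) in simp)
qed

lemma additive_reg_ge:
  assumes "\<And>(I :: nat set) p. finite I \<Longrightarrow> p ` A \<subseteq> I \<Longrightarrow> c \<le> (\<Sum>i\<in>I. \<Phi> {x \<in> A. p x = i})"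
  shows "c \<le> additive_reg \<Phi> A"
  unfolding additive_reg_def
proof (rule cInf_greatest)
  have "finite {0::nat} \<and> (\<lambda>_. 0) ` A \<subseteq> {0::nat}" by auto
  then show "{(\<Sum>i\<in>I. \<Phi> {x \<in> A. p x = i}) | (I :: nat set) p. finite I \<and> p ` A \<subseteq> I} \<noteq> {}"
    by blast
qed (use assms in auto)

text \<open>Partitions of two disjoint sets combine to a partition of the union, which gives one
  inequality. Conversely, a partition of the union restricts to both sets, and superadditivity
  compares the sums cell by cell.\<close>

lemma fin_additive_reg:
  assumes "superadditive X \<Phi>"
  shows "fin_additive X (additive_reg \<Phi>)"
  unfolding fin_additive_def
proof (intro conjI allI impI)
  fix A assume "A \<subseteq> X"
  then show "0 \<le> additive_reg \<Phi> A"
    by (intro additive_reg_ge sum_nonneg superadditive_nonneg[OF assms]) auto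
next
  fix A B assume AB: "A \<subseteq> X" "B \<subseteq> X" "A \<inter> B = {}"
  have le: "additive_reg \<Phi> (A \<union> B) \<le> (\<Sum>i\<in>I. \<Phi> {x \<in> A. p x = i}) + (\<Sum>i\<in>J. \<Phi> {x \<in> B. q x = i})"
    if pq: "finite I" "p ` A \<subseteq> I" "finite J" "q ` B \<subseteq> J" for I J :: "nat set" and p q
  proof -
    have sum01: "(\<Sum>i\<in>{0,1}. f i) = f 0 + f 1" for f :: "nat \<Rightarrow> real" by simp
    have fib: "{x \<in> A \<union> B. (if x \<in> A then 0 else 1) = (0::nat)} = A"
         "{x \<in> A \<union> B. (if x \<in> A then 0 else 1) = (1::nat)} = B"
      using AB by auto
    \<comment> \<open>The two-cell partition into \<open>A\<close> and \<open>B\<close> is refined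
      by \<open>p\<close> on \<open>A\<close> and by \<open>q\<close> on \<open>B\<close>.\<close>
    obtain K :: "nat set" and r where K: "finite K" "r ` (A \<union> B) \<subseteq> K"
      and sum: "\<And>h :: 'a set \<Rightarrow> real. (\<Sum>k\<in>K. h {x \<in> A \<union> B. r x = k})
        = (\<Sum>i\<in>{0,1::nat}. \<Sum>j\<in>(if i = 0 then I else J).
             h {x \<in> {x \<in> A \<union> B. (if x \<in> A then 0 else 1) = i}. (if i = 0 then p else q) x = j})"
      by (rule partition_glue[of "{0,1}" "\<lambda>x. if x \<in> A then 0 else 1" "A \<union> B"
            "\<lambda>i. if i = 0 then I else J" "\<lambda>i. if i = 0 then p else q"])
         (use pq AB in \<open>auto split: if_splits\<close>)
    have "additive_reg \<Phi> (A \<union> B) \<le> (\<Sum>k\<in>K. \<Phi> {x \<in> A \<union> B. r x = k})"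
      using K AB by (intro additive_reg_le[OF assms]) auto
    also have "\<dots> = (\<Sum>i\<in>I. \<Phi> {x \<in> A. p x = i}) + (\<Sum>i\<in>J. \<Phi> {x \<in> B. q x = i})"
      by (simp only: sum sum01 fib) simp
    finally show ?thesis .
  qed
  \<comment> \<open>The two infima are taken one after the other: over \<open>p\<close> with
    \<open>q\<close> fixed, then over \<open>q\<close>.\<close>
  have "additive_reg \<Phi> (A \<union> B) - additive_reg \<Phi> A \<le> additive_reg \<Phi> B"
  proof (rule additive_reg_ge)
    fix J :: "nat set" and q assume J: "finite J" "q ` B \<subseteq> J"
    have "additive_reg \<Phi> (A \<union> B) - (\<Sum>i\<in>J. \<Phi> {x \<in> B. q x = i}) \<le> additive_reg \<Phi> A"
    proof (rule additive_reg_ge)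
      fix I :: "nat set" and p assume I: "finite I" "p ` A \<subseteq> I"
      show "additive_reg \<Phi> (A \<union> B) - (\<Sum>i\<in>J. \<Phi> {x \<in> B. q x = i}) \<le> (\<Sum>i\<in>I. \<Phi> {x \<in> A. p x = i})"
        using le[OF I J] by linarith
    qed
    then show "additive_reg \<Phi> (A \<union> B) - additive_reg \<Phi> A \<le> (\<Sum>i\<in>J. \<Phi> {x \<in> B. q x = i})" by simp
  qed
  moreover have "additive_reg \<Phi> A + additive_reg \<Phi> B \<le> additive_reg \<Phi> (A \<union> B)"
  proof (rule additive_reg_ge)
    fix I :: "nat set" and p assume I: "finite I" "p ` (A \<union> B) \<subseteq> I"
    have "additive_reg \<Phi> A + additive_reg \<Phi> B
        \<le> (\<Sum>i\<in>I. \<Phi> {x \<in> A. p x = i}) + (\<Sum>i\<in>I. \<Phi> {x \<in> B. p x = i})"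
      using I AB by (intro add_mono additive_reg_le[OF assms]) auto
    also have "\<dots> \<le> (\<Sum>i\<in>I. \<Phi> {x \<in> A \<union> B. p x = i})"
      unfolding sum.distrib[symmetric]
    proof (rule sum_mono)
      fix i
      have "{x \<in> A \<union> B. p x = i} = {x \<in> A. p x = i} \<union> {x \<in> B. p x = i}" by auto
      moreover have "{x \<in> A. p x = i} \<inter> {x \<in> B. p x = i} = {}"
        "{x \<in> A. p x = i} \<subseteq> X" "{x \<in> B. p x = i} \<subseteq> X" using AB by auto
      ultimately show "\<Phi> {x \<in> A. p x = i} + \<Phi> {x \<in> B. p x = i} \<le> \<Phi> {x \<in> A \<union> B. p x = i}"
        using superadditive_Un[OF assms] by simp
    qed
    finally show "additive_reg \<Phi> A + additive_reg \<Phi> B \<le> (\<Sum>i\<in>I. \<Phi> {x \<in> A \<union> B. p x = i})" .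
  qed
  ultimately show "additive_reg \<Phi> (A \<union> B) = additive_reg \<Phi> A + additive_reg \<Phi> B" by simp
qed

section \<open>Affinity bounds under regularisation\<close>

text \<open>Cauchy-Schwarz for the vectors of square roots. Consequently, affinity sums of additive
  functions can only decrease when a partition is refined.\<close>

lemma sum_sqrt_mult_le:
  fixes f g :: "'b \<Rightarrow> real"
  assumes "\<And>i. i \<in> I \<Longrightarrow> 0 \<le> f i" "\<And>i. i \<in> I \<Longrightarrow> 0 \<le> g i"
  shows "(\<Sum>i\<in>I. sqrt (f i * g i)) \<le> sqrt (sum f I * sum g I)"
proof -
  have "(\<Sum>i\<in>I. sqrt (f i * g i)) = (\<Sum>i\<in>I. \<bar>sqrt (f i)\<bar> * \<bar>sqrt (g i)\<bar>)"
    using assms by (intro sum.cong) (auto simp: real_sqrt_mult)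
  also have "\<dots> \<le> L2_set (\<lambda>i. sqrt (f i)) I * L2_set (\<lambda>i. sqrt (g i)) I"
    by (rule L2_set_mult_ineq)
  also have "\<dots> = sqrt (sum f I * sum g I)"
    using assms by (simp add: L2_set_def real_sqrt_mult)
  finally show ?thesis .
qed

text \<open>Carries a lower bound on affinity from the superadditive \<open>\<Phi>\<close> to its
  regularisation. Each cell of \<open>p\<close> is refined until the sum of \<open>\<Phi>\<close> is
  within \<open>e\<close> of the infimum; the bound holds for the refined partition, and recombining
  its cells by Cauchy-Schwarz can only increase the affinity sum.\<close>

lemma additive_reg_affinity:
  fixes p :: "'a \<Rightarrow> nat"
  assumes \<Phi>: "superadditive X \<Phi>" and \<tau>: "fin_additive X \<tau>" and I: "finite I" "p ` X \<subseteq> I"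
    and c: "\<And>(K :: nat set) r. finite K \<Longrightarrow> r ` X \<subseteq> K
        \<Longrightarrow> c \<le> (\<Sum>k\<in>K. sqrt (\<Phi> {x \<in> X. r x = k} * \<tau> {x \<in> X. r x = k}))"
  shows "c \<le> (\<Sum>i\<in>I. sqrt (additive_reg \<Phi> {x \<in> X. p x = i} * \<tau> {x \<in> X. p x = i}))"
proof -
  have ev: "c \<le> (\<Sum>i\<in>I. sqrt ((additive_reg \<Phi> {x \<in> X. p x = i} + e) * \<tau> {x \<in> X. p x = i}))"
    if "e > 0" for e
  proof -
    \<comment> \<open>\<open>?S i J q\<close> says that \<open>q\<close> partitions the cell of
      label \<open>i\<close> and comes within \<open>e\<close> of its infimum.\<close>
    let ?S = "\<lambda>i J q. finite J \<and> q ` {x \<in> X. p x = i} \<subseteq> J \<and>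
       (\<Sum>j\<in>J. \<Phi> {x \<in> {x \<in> X. p x = i}. q x = j}) \<le> additive_reg \<Phi> {x \<in> X. p x = i} + e"
    have "\<exists>(J :: nat set) q. ?S i J q" for i
    proof (rule ccontr)
      assume none: "\<not> ?thesis"
      have "additive_reg \<Phi> {x \<in> X. p x = i} + e \<le> additive_reg \<Phi> {x \<in> X. p x = i}"
      proof (rule additive_reg_ge, rule ccontr)
        fix J :: "nat set" and q
        assume "finite J" "q ` {x \<in> X. p x = i} \<subseteq> J"
          "\<not> additive_reg \<Phi> {x \<in> X. p x = i} + e \<le> (\<Sum>j\<in>J. \<Phi> {x \<in> {x \<in> X. p x = i}. q x = j})"
        then show False by - (rule notE[OF none], rule exI[of _ J], rule exI[of _ q], simp)
      qed
      then show False using \<open>e > 0\<close> by simp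
    qed
    then have "\<forall>i. \<exists>(J :: nat set) q. ?S i J q" by (rule allI)
    from choice[OF this] obtain J :: "nat \<Rightarrow> nat set" where "\<forall>i. \<exists>q. ?S i (J i) q" by (rule exE)
    from choice[OF this] obtain q where "\<forall>i. ?S i (J i) (q i)" by (rule exE)
    then have J: "\<And>i. finite (J i)" "\<And>i. q i ` {x \<in> X. p x = i} \<subseteq> J i"
       "\<And>i. (\<Sum>j\<in>J i. \<Phi> {x \<in> {x \<in> X. p x = i}. q i x = j}) \<le> additive_reg \<Phi> {x \<in> X. p x = i} + e"
      by auto
    obtain K :: "nat set" and r where K: "finite K" "r ` X \<subseteq> K"
      and sum: "\<And>h :: 'a set \<Rightarrow> real. (\<Sum>k\<in>K. h {x \<in> X. r x = k})
        = (\<Sum>i\<in>I. \<Sum>j\<in>J i. h {x \<in> {x \<in> X. p x = i}. q i x = j})"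
      by (rule partition_glue[OF I, of J q]) (use J in auto)
    have "c \<le> (\<Sum>k\<in>K. sqrt (\<Phi> {x \<in> X. r x = k} * \<tau> {x \<in> X. r x = k}))"
      by (rule c) fact+
    also have "\<dots> = (\<Sum>i\<in>I. \<Sum>j\<in>J i. sqrt (\<Phi> {x \<in> {x \<in> X. p x = i}. q i x = j} *
         \<tau> {x \<in> {x \<in> X. p x = i}. q i x = j}))"
      by (rule sum[of "\<lambda>A. sqrt (\<Phi> A * \<tau> A)"])
    also have "\<dots> \<le> (\<Sum>i\<in>I. sqrt ((\<Sum>j\<in>J i. \<Phi> {x \<in> {x \<in> X. p x = i}. q i x = j}) *
         (\<Sum>j\<in>J i. \<tau> {x \<in> {x \<in> X. p x = i}. q i x = j})))"
      by (intro sum_mono sum_sqrt_mult_le superadditive_nonneg[OF \<Phi>] fin_additive_nonneg[OF \<tau>]) auto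
    also have "\<dots> \<le> (\<Sum>i\<in>I. sqrt ((additive_reg \<Phi> {x \<in> X. p x = i} + e) * \<tau> {x \<in> X. p x = i}))"
    proof (intro sum_mono real_sqrt_le_mono)
      fix i
      have "(\<Sum>j\<in>J i. \<tau> {x \<in> {x \<in> X. p x = i}. q i x = j}) = \<tau> {x \<in> X. p x = i}"
        using J by (intro fin_additive_sum_partition[OF \<tau>]) auto
      moreover have "0 \<le> \<tau> {x \<in> X. p x = i}" by (intro fin_additive_nonneg[OF \<tau>]) auto
      ultimately show "(\<Sum>j\<in>J i. \<Phi> {x \<in> {x \<in> X. p x = i}. q i x = j}) *
          (\<Sum>j\<in>J i. \<tau> {x \<in> {x \<in> X. p x = i}. q i x = j})
          \<le> (additive_reg \<Phi> {x \<in> X. p x = i} + e) * \<tau> {x \<in> X. p x = i}"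
        using J(3)[of i] by (simp add: mult_right_mono)
    qed
    finally show ?thesis .
  qed
  \<comment> \<open>The finite sum is continuous in \<open>e\<close>, so the bound survives the
    limit \<open>e\<close> to 0 from the right.\<close>
  have "((\<lambda>e. \<Sum>i\<in>I. sqrt ((additive_reg \<Phi> {x \<in> X. p x = i} + e) * \<tau> {x \<in> X. p x = i}))
      \<longlongrightarrow> (\<Sum>i\<in>I. sqrt ((additive_reg \<Phi> {x \<in> X. p x = i} + 0) * \<tau> {x \<in> X. p x = i}))) (at_right 0)"
    by (intro tendsto_intros)
  moreover have "eventually (\<lambda>e. c \<le> (\<Sum>i\<in>I. sqrt ((additive_reg \<Phi> {x \<in> X. p x = i} + e)
      * \<tau> {x \<in> X. p x = i}))) (at_right (0::real))"
    using ev by (simp add: eventually_at_filter)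
  ultimately have "c \<le> (\<Sum>i\<in>I. sqrt ((additive_reg \<Phi> {x \<in> X. p x = i} + 0) * \<tau> {x \<in> X. p x = i}))"
    by (rule tendsto_lowerbound) simp
  then show ?thesis by simp
qed

section \<open>The midpoint of two square roots\<close>

definition half_mean :: "('a set \<Rightarrow> real) \<Rightarrow> ('a set \<Rightarrow> real) \<Rightarrow> 'a set \<Rightarrow> real" where
  "half_mean \<nu>1 \<nu>2 A = ((sqrt (\<nu>1 A) + sqrt (\<nu>2 A)) / 2)\<^sup>2"

lemma half_mean_eq:
  assumes "0 \<le> \<nu>1 A" "0 \<le> \<nu>2 A"
  shows "half_mean \<nu>1 \<nu>2 A = (\<nu>1 A + \<nu>2 A + 2 * sqrt (\<nu>1 A * \<nu>2 A)) / 4"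
  using assms by (simp add: half_mean_def power2_sum power_divide real_sqrt_mult)

text \<open>Expanding the square leaves an additive part plus half the geometric mean, which is
  superadditive by Cauchy-Schwarz with two terms.\<close>

lemma superadditive_half_mean:
  assumes "fin_additive X \<nu>1" "fin_additive X \<nu>2"
  shows "superadditive X (half_mean \<nu>1 \<nu>2)"
  unfolding superadditive_def
proof (intro conjI allI impI)
  fix A B assume AB: "A \<subseteq> X" "B \<subseteq> X" "A \<inter> B = {}"
  have "sqrt (\<nu>1 A * \<nu>2 A) + sqrt (\<nu>1 B * \<nu>2 B) \<le> sqrt ((\<nu>1 A + \<nu>1 B) * (\<nu>2 A + \<nu>2 B))"
    using sum_sqrt_mult_le[of "UNIV::bool set" "\<lambda>b. if b then \<nu>1 A else \<nu>1 B" "\<lambda>b. if b then \<nu>2 A else \<nu>2 B"]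
      AB assms by (simp add: UNIV_bool fin_additive_nonneg add.commute)
  moreover have "0 \<le> \<nu>1 A" "0 \<le> \<nu>2 A" "0 \<le> \<nu>1 B" "0 \<le> \<nu>2 B"
    using AB assms by (auto simp: fin_additive_nonneg)
  ultimately show "half_mean \<nu>1 \<nu>2 A + half_mean \<nu>1 \<nu>2 B \<le> half_mean \<nu>1 \<nu>2 (A \<union> B)"
    using AB assms by (simp add: half_mean_eq fin_additive_Un field_simps)
qed (simp add: half_mean_def)

text \<open>The right side is four times the square of \<open>sqrt a - sqrt b\<close>, and the other
  factor \<open>sqrt a + sqrt b\<close> of \<open>a - b\<close> is at most 2.\<close>

lemma sqrt_diff_sq_ge:
  assumes "0 \<le> a" "a \<le> 1" "0 \<le> b" "b \<le> (1::real)"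
  shows "(a - b)\<^sup>2 \<le> 4 * (a + b - 2 * sqrt (a * b))"
proof -
  have "(a - b)\<^sup>2 = ((sqrt a + sqrt b) * (sqrt a - sqrt b))\<^sup>2"
    using assms by (simp add: algebra_simps)
  also have "\<dots> = (sqrt a + sqrt b)\<^sup>2 * (sqrt a - sqrt b)\<^sup>2" by (rule power_mult_distrib)
  also have "\<dots> \<le> 2\<^sup>2 * (sqrt a - sqrt b)\<^sup>2"
    using assms by (intro mult_right_mono power_mono)
      (auto intro: order_trans[OF add_mono[of "sqrt a" 1 "sqrt b" 1]])
  also have "\<dots> = 4 * (a + b - 2 * sqrt (a * b))"
    using assms by (simp add: power2_diff real_sqrt_mult)
  finally show ?thesis .
qed

text \<open>Quantifies how much shorter than 1 the midpoint is when the two functions differ on a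
  single set \<open>A\<close>: the infimum is tested on the partition into \<open>A\<close> and its
  complement.\<close>

lemma additive_reg_half_mean_total:
  assumes "fin_additive X \<nu>1" "\<nu>1 X = 1" "fin_additive X \<nu>2" "\<nu>2 X = 1" "A \<subseteq> X"
  shows "additive_reg (half_mean \<nu>1 \<nu>2) X \<le> 1 - (\<nu>1 A - \<nu>2 A)\<^sup>2 / 16"
proof -
  have c: "\<nu> (X - A) = 1 - \<nu> A" "0 \<le> \<nu> A" "\<nu> A \<le> 1" if "fin_additive X \<nu>" "\<nu> X = 1" for \<nu>
    using fin_additive_Un[OF that(1), of A "X - A"] fin_additive_mono[OF that(1) assms(5)] that assms(5)
    by (auto simp: Un_absorb1 fin_additive_nonneg)
  have fib: "{x \<in> X. (if x \<in> A then 0 else 1) = (0::nat)} = A"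
     "{x \<in> X. (if x \<in> A then 0 else 1) = (1::nat)} = X - A"
    using assms(5) by auto
  have "additive_reg (half_mean \<nu>1 \<nu>2) X \<le>
      (\<Sum>i\<in>{0,1}. half_mean \<nu>1 \<nu>2 {x \<in> X. (if x \<in> A then 0 else 1) = (i::nat)})"
    by (rule additive_reg_le[OF superadditive_half_mean]) (use assms in auto)
  also have "\<dots> = half_mean \<nu>1 \<nu>2 A + half_mean \<nu>1 \<nu>2 (X - A)" using fib by simp
  also have "\<dots> = (2 + 2 * sqrt (\<nu>1 A * \<nu>2 A) + 2 * sqrt ((1 - \<nu>1 A) * (1 - \<nu>2 A))) / 4"
  proof -
    have "half_mean \<nu>1 \<nu>2 (X - A) = (1 - \<nu>1 A + (1 - \<nu>2 A) + 2 * sqrt ((1 - \<nu>1 A) * (1 - \<nu>2 A))) / 4"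
      using half_mean_eq[of \<nu>1 "X - A" \<nu>2] c[OF assms(1,2)] c[OF assms(3,4)] by simp
    moreover have "half_mean \<nu>1 \<nu>2 A = (\<nu>1 A + \<nu>2 A + 2 * sqrt (\<nu>1 A * \<nu>2 A)) / 4"
      using c[OF assms(1,2)] c[OF assms(3,4)] by (intro half_mean_eq)
    ultimately show ?thesis by (simp add: add_divide_distrib diff_divide_distrib)
  qed
  \<comment> \<open>Only the loss on \<open>A\<close> is kept, the loss on the complement being
    nonnegative. The 16 combines the 4 of \<open>sqrt_diff_sq_ge\<close> with the 4 of
    \<open>half_mean_eq\<close>.\<close>
  also have "\<dots> \<le> 1 - (\<nu>1 A - \<nu>2 A)\<^sup>2 / 16"
  proof -
    have "0 \<le> (1 - \<nu>1 A) + (1 - \<nu>2 A) - 2 * sqrt ((1 - \<nu>1 A) * (1 - \<nu>2 A))"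
      using arith_geo_mean_sqrt[of "1 - \<nu>1 A" "1 - \<nu>2 A"] c[OF assms(1,2)] c[OF assms(3,4)] by simp
    then show ?thesis
      using sqrt_diff_sq_ge[of "\<nu>1 A" "\<nu>2 A"] c[OF assms(1,2)] c[OF assms(3,4)] by simp
  qed
  finally show ?thesis .
qed


section \<open>Means and their affinity with translates\<close>

lemma fa_mean_iff: "fa_mean G \<mu> \<longleftrightarrow> fin_additive (carrier G) \<mu> \<and> \<mu> (carrier G) = 1"
proof
  assume R: "fin_additive (carrier G) \<mu> \<and> \<mu> (carrier G) = 1"
  then have "\<mu> A \<le> 1" if "A \<subseteq> carrier G" for A
    using fin_additive_mono[of "carrier G" \<mu> A "carrier G"] that by simp
  then show "fa_mean G \<mu>" using R by (simp add: fa_mean_def fin_additive_def)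
qed (simp add: fa_mean_def fin_additive_def)

text \<open>The affinity of \<open>\<nu>\<close> with each translate of \<open>\<mu>\<close>, an infimum over finite partitions, is at
  least \<open>c\<close>.\<close>

definition affinity_ge ::
  "('a, 'b) monoid_scheme \<Rightarrow> ('a set \<Rightarrow> real) \<Rightarrow> ('a set \<Rightarrow> real) \<Rightarrow> real \<Rightarrow> bool" where
  "affinity_ge G \<mu> \<nu> c \<longleftrightarrow> (\<forall>g\<in>carrier G. \<forall>(I :: nat set) p. finite I \<longrightarrow> p ` carrier G \<subseteq> I \<longrightarrow>
     c \<le> (\<Sum>i\<in>I. sqrt (\<nu> {x \<in> carrier G. p x = i} * \<mu> (g <#\<^bsub>G\<^esub> {x \<in> carrier G. p x = i}))))"

lemma affinity_geD:
  fixes p :: "'a \<Rightarrow> nat"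
  assumes "affinity_ge G \<mu> \<nu> c" "g \<in> carrier G" "finite I" "p ` carrier G \<subseteq> I"
  shows "c \<le> (\<Sum>i\<in>I. sqrt (\<nu> {x \<in> carrier G. p x = i} * \<mu> (g <#\<^bsub>G\<^esub> {x \<in> carrier G. p x = i})))"
  using assms unfolding affinity_ge_def by blast

lemma affinity_geI:
  assumes "\<And>g (I :: nat set) p. g \<in> carrier G \<Longrightarrow> finite I \<Longrightarrow> p ` carrier G \<subseteq> I \<Longrightarrow>
     c \<le> (\<Sum>i\<in>I. sqrt (\<nu> {x \<in> carrier G. p x = i} * \<mu> (g <#\<^bsub>G\<^esub> {x \<in> carrier G. p x = i})))"
  shows "affinity_ge G \<mu> \<nu> c"
  using assms unfolding affinity_ge_def by blast

lemma affinity_ge_mono: "affinity_ge G \<mu> \<nu> c \<Longrightarrow> b \<le> c \<Longrightarrow> affinity_ge G \<mu> \<nu> b"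
  by (rule affinity_geI) (rule order_trans, assumption, rule affinity_geD)

section \<open>Left translation and the left defect\<close>

context group
begin

lemma mem_l_coset_iff:
  assumes "g \<in> carrier G" "A \<subseteq> carrier G"
  shows "x \<in> g <# A \<longleftrightarrow> x \<in> carrier G \<and> inv g \<otimes> x \<in> A"
proof
  assume "x \<in> g <# A"
  then obtain a where "a \<in> A" "x = g \<otimes> a" by (auto simp: l_coset_def)
  then show "x \<in> carrier G \<and> inv g \<otimes> x \<in> A"
    using assms by (auto simp: m_assoc[symmetric])
next
  assume x: "x \<in> carrier G \<and> inv g \<otimes> x \<in> A"
  then have "x = g \<otimes> (inv g \<otimes> x)" using assms by (simp add: m_assoc[symmetric])
  then show "x \<in> g <# A" using x by (auto simp: l_coset_def)
qed

lemma l_coset_carrier_self: "g \<in> carrier G \<Longrightarrow> g <# carrier G = carrier G"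
  by (auto simp: mem_l_coset_iff)

text \<open>Translating a partition yields a partition of the same form, with its labelling
  precomposed with \<open>inv g\<close>.\<close>

lemma l_coset_fibre:
  assumes "g \<in> carrier G"
  shows "g <# {x \<in> carrier G. p x = i} = {x \<in> carrier G. p (inv g \<otimes> x) = i}"
  using assms mem_l_coset_iff[of g "{x \<in> carrier G. p x = i}"] by auto

lemma fin_additive_translate:
  assumes "fin_additive (carrier G) \<nu>" "g \<in> carrier G"
  shows "fin_additive (carrier G) (\<lambda>A. \<nu> (g <# A))"
  unfolding fin_additive_def
proof (intro conjI allI impI)
  fix A B assume AB: "A \<subseteq> carrier G" "B \<subseteq> carrier G" "A \<inter> B = {}"
  have "g <# (A \<union> B) = (g <# A) \<union> (g <# B)" by (auto simp: l_coset_def)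
  moreover have "(g <# A) \<inter> (g <# B) = {}"
    using AB assms by (auto simp: mem_l_coset_iff)
  ultimately show "\<nu> (g <# (A \<union> B)) = \<nu> (g <# A) + \<nu> (g <# B)"
    using AB assms fin_additive_Un[OF assms(1)] by (simp add: l_coset_subset_G)
qed (use assms in \<open>simp add: fin_additive_nonneg l_coset_subset_G\<close>)

lemma fa_mean_translate:
  "fa_mean G \<nu> \<Longrightarrow> g \<in> carrier G \<Longrightarrow> fa_mean G (\<lambda>A. \<nu> (g <# A))"
  by (simp add: fa_mean_iff fin_additive_translate l_coset_carrier_self)

lemma left_defect_upper:
  assumes "fa_mean G \<mu>" "g \<in> carrier G" "A \<subseteq> carrier G"
  shows "\<bar>\<mu> (g <# A) - \<mu> A\<bar> \<le> left_defect G \<mu>"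
  unfolding left_defect_def
proof (rule cSup_upper)
  show "bdd_above {\<bar>\<mu> (g <# A) - \<mu> A\<bar> |g A. g \<in> carrier G \<and> A \<subseteq> carrier G}"
  proof (rule bdd_aboveI[of _ 1], clarify)
    fix g A assume "g \<in> carrier G" "A \<subseteq> carrier G"
    then show "\<bar>\<mu> (g <# A) - \<mu> A\<bar> \<le> 1"
      using assms(1) l_coset_subset_G[of A g] unfolding fa_mean_def by (smt (verit))
  qed
qed (use assms in blast)

lemma left_defect_least:
  assumes "\<And>g A. g \<in> carrier G \<Longrightarrow> A \<subseteq> carrier G \<Longrightarrow> \<bar>\<mu> (g <# A) - \<mu> A\<bar> \<le> c"
  shows "left_defect G \<mu> \<le> c"
  unfolding left_defect_def by (rule cSup_least) (use assms in blast)+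

lemma left_defect_nonneg: "fa_mean G \<mu> \<Longrightarrow> 0 \<le> left_defect G \<mu>"
  using left_defect_upper[of \<mu> \<one> "{}"] by simp

lemma left_defect_le_1: "fa_mean G \<mu> \<Longrightarrow> left_defect G \<mu> \<le> 1"
proof (rule left_defect_least)
  fix g A assume "fa_mean G \<mu>" "g \<in> carrier G" "A \<subseteq> carrier G"
  then show "\<bar>\<mu> (g <# A) - \<mu> A\<bar> \<le> 1"
    using l_coset_subset_G[of A g] unfolding fa_mean_def by (smt (verit))
qed

section \<open>Stability of affinity bounds\<close>

text \<open>The sum of the cellwise minima of \<open>\<mu>\<close> and its translate is 1 minus
  their difference on one set, the union of the cells where \<open>\<mu>\<close> is not the larger.
  That difference is at most the defect, and each minimum is at most the geometric mean.\<close>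

lemma affinity_ge_self:
  assumes \<mu>: "fa_mean G \<mu>"
  shows "affinity_ge G \<mu> \<mu> (1 - left_defect G \<mu>)"
proof (rule affinity_geI)
  fix g and I :: "nat set" and p
  assume g: "g \<in> carrier G" and I: "finite I" "p ` carrier G \<subseteq> I"
  let ?P = "\<lambda>i. {x \<in> carrier G. p x = i}"
  let ?\<nu> = "\<lambda>A. \<mu> (g <# A)"
  have add: "fin_additive (carrier G) \<mu>" "fin_additive (carrier G) ?\<nu>"
    using \<mu> g by (auto simp: fa_mean_iff fin_additive_translate)
  have nn: "0 \<le> \<mu> (?P i)" "0 \<le> ?\<nu> (?P i)" for i
    by (rule fin_additive_nonneg[OF add(1)] fin_additive_nonneg[OF add(2)], auto)+
  define L where "L = {i \<in> I. \<mu> (?P i) \<le> ?\<nu> (?P i)}"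
  define A where "A = {x \<in> carrier G. p x \<in> L}"
  have L: "L \<subseteq> I" "finite L" using I by (auto simp: L_def)
  have "1 - left_defect G \<mu> \<le> 1 - (?\<nu> A - \<mu> A)"
    using left_defect_upper[OF \<mu> g, of A] by (auto simp: A_def)
  also have "\<dots> = (\<Sum>i\<in>L. \<mu> (?P i)) + (\<Sum>i\<in>I - L. ?\<nu> (?P i))"
  proof -
    have "(\<Sum>i\<in>I - L. ?\<nu> (?P i)) = (\<Sum>i\<in>I. ?\<nu> (?P i)) - (\<Sum>i\<in>L. ?\<nu> (?P i))"
      using I(1) L by (intro sum_diff) auto
    also have "(\<Sum>i\<in>I. ?\<nu> (?P i)) = ?\<nu> (carrier G)"
      using I by (intro fin_additive_sum_partition[OF add(2)]) auto
    also have "(\<Sum>i\<in>L. ?\<nu> (?P i)) = ?\<nu> A"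
      using fin_additive_sum_fibres[OF add(2) subset_refl L(2), of p] by (simp add: A_def)
    finally show ?thesis
      using fin_additive_sum_fibres[OF add(1) subset_refl L(2), of p] g \<mu>
      by (simp add: A_def l_coset_carrier_self fa_mean_def)
  qed
  also have "\<dots> \<le> (\<Sum>i\<in>L. sqrt (\<mu> (?P i) * ?\<nu> (?P i))) + (\<Sum>i\<in>I - L. sqrt (\<mu> (?P i) * ?\<nu> (?P i)))"
  proof (intro add_mono sum_mono real_le_rsqrt)
    fix i assume "i \<in> L"
    then show "(\<mu> (?P i))\<^sup>2 \<le> \<mu> (?P i) * ?\<nu> (?P i)"
      unfolding power2_eq_square by (intro mult_left_mono nn) (auto simp: L_def)
  next
    fix i assume "i \<in> I - L"
    then show "(?\<nu> (?P i))\<^sup>2 \<le> \<mu> (?P i) * ?\<nu> (?P i)"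
      unfolding power2_eq_square by (intro mult_right_mono nn) (auto simp: L_def)
  qed
  also have "\<dots> = (\<Sum>i\<in>I. sqrt (\<mu> (?P i) * ?\<nu> (?P i)))"
    using I(1) L by (subst add.commute) (intro sum.subset_diff[symmetric])
  finally show "1 - left_defect G \<mu> \<le> (\<Sum>i\<in>I. sqrt (\<mu> (?P i) * \<mu> (g <# ?P i)))" .
qed

text \<open>The translates of \<open>\<mu>\<close> are merely permuted: the bound is applied to
  \<open>g \<otimes> inv h\<close> and to the partition translated by \<open>h\<close>.\<close>

lemma affinity_ge_translate:
  assumes "affinity_ge G \<mu> \<nu> c" "h \<in> carrier G"
  shows "affinity_ge G \<mu> (\<lambda>A. \<nu> (h <# A)) c"
proof (rule affinity_geI)
  fix g and I :: "nat set" and p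
  assume g: "g \<in> carrier G" and I: "finite I" "p ` carrier G \<subseteq> I"
  have eq: "(g \<otimes> inv h) <# (h <# {x \<in> carrier G. p x = i}) = g <# {x \<in> carrier G. p x = i}" for i
    using g assms(2) by (subst lcos_m_assoc) (auto simp: m_assoc)
  have "c \<le> (\<Sum>i\<in>I. sqrt (\<nu> {x \<in> carrier G. p (inv h \<otimes> x) = i}
      * \<mu> ((g \<otimes> inv h) <# {x \<in> carrier G. p (inv h \<otimes> x) = i})))"
    using I g assms(2) by (intro affinity_geD[OF assms(1)]) auto
  then show "c \<le> (\<Sum>i\<in>I. sqrt (\<nu> (h <# {x \<in> carrier G. p x = i}) * \<mu> (g <# {x \<in> carrier G. p x = i})))"
    using assms(2) eq by (simp add: l_coset_fibre)
qed

text \<open>The square root of \<open>half_mean\<close> is the average of the two square roots, so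
  its affinity sums are averages too. The regularisation keeps the bound by
  \<open>additive_reg_affinity\<close>, with the translate of \<open>\<mu>\<close> as
  \<open>\<tau>\<close>.\<close>

lemma affinity_ge_half_mean:
  assumes \<mu>: "fin_additive (carrier G) \<mu>"
    and \<nu>: "fin_additive (carrier G) \<nu>1" "fin_additive (carrier G) \<nu>2"
    and c: "affinity_ge G \<mu> \<nu>1 c" "affinity_ge G \<mu> \<nu>2 c"
  shows "affinity_ge G \<mu> (additive_reg (half_mean \<nu>1 \<nu>2)) c"
proof (rule affinity_geI)
  fix g and I :: "nat set" and p
  assume g: "g \<in> carrier G" and I: "finite I" "p ` carrier G \<subseteq> I"
  show "c \<le> (\<Sum>i\<in>I. sqrt (additive_reg (half_mean \<nu>1 \<nu>2) {x \<in> carrier G. p x = i} *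
         \<mu> (g <# {x \<in> carrier G. p x = i})))"
  proof (rule additive_reg_affinity[OF superadditive_half_mean[OF \<nu>] fin_additive_translate[OF \<mu> g] I])
    fix K :: "nat set" and r
    assume K: "finite K" "r ` carrier G \<subseteq> K"
    let ?R = "\<lambda>k. {x \<in> carrier G. r x = k}"
    have "c \<le> ((\<Sum>k\<in>K. sqrt (\<nu>1 (?R k) * \<mu> (g <# ?R k))) + (\<Sum>k\<in>K. sqrt (\<nu>2 (?R k) * \<mu> (g <# ?R k)))) / 2"
      using affinity_geD[OF c(1) g K] affinity_geD[OF c(2) g K] by simp
    also have "\<dots> = (\<Sum>k\<in>K. sqrt (half_mean \<nu>1 \<nu>2 (?R k) * \<mu> (g <# ?R k)))"
      unfolding sum.distrib[symmetric] sum_divide_distrib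
    proof (rule sum.cong)
      fix k
      have "0 \<le> \<nu>1 (?R k)" "0 \<le> \<nu>2 (?R k)" by (auto intro!: fin_additive_nonneg[OF \<nu>(1)] fin_additive_nonneg[OF \<nu>(2)])
      then show "(sqrt (\<nu>1 (?R k) * \<mu> (g <# ?R k)) + sqrt (\<nu>2 (?R k) * \<mu> (g <# ?R k))) / 2
          = sqrt (half_mean \<nu>1 \<nu>2 (?R k) * \<mu> (g <# ?R k))"
        by (simp add: half_mean_def real_sqrt_mult ring_distribs)
    qed simp
    finally show "c \<le> (\<Sum>k\<in>K. sqrt (half_mean \<nu>1 \<nu>2 (?R k) * \<mu> (g <# ?R k)))" .
  qed
qed

text \<open>Tested on the one-cell partition. It shows that affinities of means are at most 1 and
  that the midpoint has positive mass, so that it can be normalised.\<close>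

lemma affinity_ge_total:
  assumes "affinity_ge G \<mu> \<nu> c" "fa_mean G \<mu>"
  shows "c \<le> sqrt (\<nu> (carrier G))"
  using affinity_geD[OF assms(1) one_closed, of "{0}" "\<lambda>_. 0"] assms(2)
  by (auto simp: l_coset_carrier_self fa_mean_def)

lemma affinity_ge_normalise:
  assumes "affinity_ge G \<mu> \<nu> c" "m > 0"
  shows "affinity_ge G \<mu> (\<lambda>A. \<nu> A / m) (c / sqrt m)"
proof (rule affinity_geI)
  fix g and I :: "nat set" and p
  assume g: "g \<in> carrier G" and I: "finite I" "p ` carrier G \<subseteq> I"
  have "c / sqrt m \<le> (\<Sum>i\<in>I. sqrt (\<nu> {x \<in> carrier G. p x = i} * \<mu> (g <# {x \<in> carrier G. p x = i}))) / sqrt m"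
    using affinity_geD[OF assms(1) g I] assms(2) by (intro divide_right_mono) auto
  then show "c / sqrt m \<le> (\<Sum>i\<in>I. sqrt (\<nu> {x \<in> carrier G. p x = i} / m * \<mu> (g <# {x \<in> carrier G. p x = i})))"
    by (simp add: sum_divide_distrib real_sqrt_divide real_sqrt_mult)
qed

section \<open>Near-maximisers and means of small defect\<close>

text \<open>Uniform convexity: the midpoint still has affinity \<open>C - e\<close>, so after
  normalisation its affinity \<open>(C - e) / sqrt m\<close> cannot exceed \<open>C\<close>. This
  bounds the mass \<open>m\<close> from below, while a discrepancy on \<open>A\<close> bounds it
  from above.\<close>

lemma affinity_near_max_close:
  assumes \<mu>: "fa_mean G \<mu>"
    and max: "\<And>\<nu> c. fa_mean G \<nu> \<Longrightarrow> affinity_ge G \<mu> \<nu> c \<Longrightarrow> c \<le> C"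
    and e: "0 < e" "e < C"
    and \<nu>1: "fa_mean G \<nu>1" "affinity_ge G \<mu> \<nu>1 (C - e)"
    and \<nu>2: "fa_mean G \<nu>2" "affinity_ge G \<mu> \<nu>2 (C - e)"
    and A: "A \<subseteq> carrier G"
  shows "(\<nu>1 A - \<nu>2 A)\<^sup>2 \<le> 32 * e / C"
proof -
  have add: "fin_additive (carrier G) \<mu>" "fin_additive (carrier G) \<nu>1" "fin_additive (carrier G) \<nu>2"
    using \<mu> \<nu>1 \<nu>2 by (auto simp: fa_mean_iff)
  define \<sigma> where "\<sigma> = additive_reg (half_mean \<nu>1 \<nu>2)"
  define m where "m = \<sigma> (carrier G)"
  define D where "D = (\<nu>1 A - \<nu>2 A)\<^sup>2"
  have \<sigma>: "fin_additive (carrier G) \<sigma>"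
    unfolding \<sigma>_def by (intro fin_additive_reg superadditive_half_mean add)
  have ge: "affinity_ge G \<mu> \<sigma> (C - e)"
    unfolding \<sigma>_def by (intro affinity_ge_half_mean add \<nu>1 \<nu>2)
  have "0 < sqrt m"
    using affinity_ge_total[OF ge \<mu>] e unfolding m_def by linarith
  then have m: "m > 0" by simp
  have "fa_mean G (\<lambda>A. \<sigma> A / m)"
    using \<sigma> m by (auto simp: fa_mean_iff fin_additive_def add_divide_distrib m_def)
  then have "(C - e) / sqrt m \<le> C"
    by (rule max) (rule affinity_ge_normalise[OF ge m])
  then have "C - e \<le> C * sqrt m" using m by (simp add: field_simps)
  then have "(C - e)\<^sup>2 \<le> (C * sqrt m)\<^sup>2" using e by (intro power_mono) auto
  also have "\<dots> = C\<^sup>2 * m" using m by (simp add: power_mult_distrib)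
  also have "\<dots> \<le> C\<^sup>2 * (1 - D / 16)"
    using additive_reg_half_mean_total[OF add(2) _ add(3) _ A] \<nu>1 \<nu>2
    by (intro mult_left_mono) (auto simp: m_def \<sigma>_def D_def fa_mean_iff)
  \<comment> \<open>The linear term \<open>2 * C * e\<close> of the expanded square, multiplied by
    16, yields the constant 32.\<close>
  finally have "C * (C * D) \<le> C * (32 * e) - 16 * e\<^sup>2"
    by (simp add: power2_eq_square algebra_simps)
  then have "C * (C * D) \<le> C * (32 * e)" using zero_le_power2[of e] by linarith
  then have "C * D \<le> 32 * e" using e by simp
  then show ?thesis using e by (simp add: D_def field_simps)
qed

lemma small_left_defect:
  assumes \<mu>: "fa_mean G \<mu>" "left_defect G \<mu> < 1" and "\<epsilon> > 0"
  shows "\<exists>\<nu>. fa_mean G \<nu> \<and> left_defect G \<nu> \<le> \<epsilon>"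
proof -
  define S where "S = {c. \<exists>\<nu>. fa_mean G \<nu> \<and> affinity_ge G \<mu> \<nu> c}"
  define C where "C = Sup S"
  have "c \<le> 1" if "c \<in> S" for c
    using that affinity_ge_total[OF _ \<mu>(1)] by (fastforce simp: S_def fa_mean_def)
  then have bdd: "bdd_above S" by (rule bdd_aboveI)
  have mem: "1 - left_defect G \<mu> \<in> S"
    using \<mu>(1) affinity_ge_self by (auto simp: S_def)
  have "1 - left_defect G \<mu> \<le> C" unfolding C_def by (rule cSup_upper[OF mem bdd])
  then have C: "C > 0" using \<mu>(2) by simp
  have max: "c \<le> C" if "fa_mean G \<nu>" "affinity_ge G \<mu> \<nu> c" for \<nu> c
    unfolding C_def by (rule cSup_upper[OF _ bdd]) (use that in \<open>auto simp: S_def\<close>)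
  \<comment> \<open>The first entry keeps \<open>e\<close> below \<open>C\<close>; the second makes
    the bound of \<open>affinity_near_max_close\<close> at most the square of
    \<open>\<epsilon>\<close>.\<close>
  define e where "e = min (C / 2) (C * \<epsilon>\<^sup>2 / 32)"
  have e: "0 < e" "e < C" "32 * e / C \<le> \<epsilon>\<^sup>2"
    using C \<open>\<epsilon> > 0\<close> by (auto simp: e_def min_def field_simps)
  have "C - e < Sup S" using e by (simp add: C_def)
  then obtain c where "c \<in> S" "C - e < c" using mem less_cSupD[of S "C - e"] by blast
  then obtain \<nu> where \<nu>: "fa_mean G \<nu>" "affinity_ge G \<mu> \<nu> (C - e)"
    using affinity_ge_mono[of G \<mu> _ c "C - e"] by (auto simp: S_def)
  have "left_defect G \<nu> \<le> \<epsilon>"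
  proof (rule left_defect_least)
    fix g A assume g: "g \<in> carrier G" and A: "A \<subseteq> carrier G"
    \<comment> \<open>The translate of \<open>\<nu>\<close> is a near-maximiser as well, so the two
      are close on every set.\<close>
    have "(\<nu> (g <# A) - \<nu> A)\<^sup>2 \<le> 32 * e / C"
      by (rule affinity_near_max_close[OF \<mu>(1) max e(1,2) fa_mean_translate[OF \<nu>(1) g]
            affinity_ge_translate[OF \<nu>(2) g] \<nu> A])
    also have "\<dots> \<le> \<epsilon>\<^sup>2" by (rule e)
    finally show "\<bar>\<nu> (g <# A) - \<nu> A\<bar> \<le> \<epsilon>"
      using \<open>\<epsilon> > 0\<close> by (simp add: abs_le_square_iff[symmetric])
  qed
  then show ?thesis using \<nu>(1) by blast
qed

section \<open>Attainment of the infimum\<close>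

lemma fa_mean_point_mass: "fa_mean G (\<lambda>A. if \<one> \<in> A then 1 else 0)"
  by (auto simp: fa_mean_def)

lemma group_defect_le:
  assumes "fa_mean G \<mu>" shows "group_defect G \<le> left_defect G \<mu>"
  unfolding group_defect_def
proof (rule cInf_lower)
  show "bdd_below {left_defect G \<mu> |\<mu>. fa_mean G \<mu>}"
    by (rule bdd_belowI[of _ 0]) (auto simp: left_defect_nonneg)
qed (use assms in blast)

text \<open>The sets \<open>K e\<close> of means within \<open>e\<close> of the infimum are closed
  and shrink with \<open>e\<close>. Compactness gives a common point with all of them, and its
  defect is at most the infimum.\<close>

lemma group_defect_attained: "\<exists>\<mu>. fa_mean G \<mu> \<and> group_defect G = left_defect G \<mu>"
proof -
  let ?B = "{\<mu> :: 'a set \<Rightarrow> real. \<forall>A. \<mu> A \<in> {0..1}}"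
  define K where "K e = {\<mu> :: 'a set \<Rightarrow> real. fa_mean G \<mu> \<and>
     (\<forall>g A. g \<in> carrier G \<and> A \<subseteq> carrier G \<longrightarrow> \<bar>\<mu> (g <# A) - \<mu> A\<bar> \<le> group_defect G + e)}" for e
  have K_mono: "K e \<subseteq> K x" if "e \<le> x" for e x
  proof
    fix \<mu> assume \<mu>: "\<mu> \<in> K e"
    show "\<mu> \<in> K x"
      unfolding K_def mem_Collect_eq
    proof (intro conjI allI impI)
      fix g A assume "g \<in> carrier G \<and> A \<subseteq> carrier G"
      then have "\<bar>\<mu> (g <# A) - \<mu> A\<bar> \<le> group_defect G + e" using \<mu> by (simp add: K_def)
      then show "\<bar>\<mu> (g <# A) - \<mu> A\<bar> \<le> group_defect G + x" using that by simp
    qed (use \<mu> in \<open>simp add: K_def\<close>)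
  qed
  have cont: "continuous_on UNIV (\<lambda>\<mu> :: 'a set \<Rightarrow> real. \<mu> A)" for A
    by simp
  \<comment> \<open>Tychonoff: the box of all functions with values in the unit interval is
    compact.\<close>
  have "compactin (product_topology (\<lambda>_. euclidean) UNIV) (PiE UNIV (\<lambda>_ :: 'a set. {0..1::real}))"
    by (subst compactin_PiE) simp
  moreover have "PiE UNIV (\<lambda>_. {0..1}) = ?B" by auto
  ultimately have B: "compact ?B" by (simp add: euclidean_product_topology)
  have "?B \<inter> \<Inter> (K ` {0<..}) \<noteq> {}"
  proof (rule compact_imp_fip[OF B])
    fix T assume "T \<in> K ` {0<..}"
    then obtain e where "T = K e" by auto
    \<comment> \<open>Every condition defining \<open>K e\<close> compares finitely many
      coordinates, which are continuous in the product topology.\<close>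
    then show "closed T"
      unfolding K_def fa_mean_def
      by (simp only:) (intro closed_Collect_conj closed_Collect_all closed_Collect_imp open_Collect_const
          closed_Collect_le closed_Collect_eq continuous_intros cont)
  next
    fix F assume F: "finite F" "F \<subseteq> K ` {0<..}"
    then obtain E where E: "E \<subseteq> {0<..}" "finite E" "F = K ` E" by (meson finite_subset_image)
    \<comment> \<open>Inserting 1 keeps \<open>Min\<close> meaningful for empty \<open>E\<close>. By
      monotonicity one point of \<open>K e\<close> lies in the whole finite family.\<close>
    define e where "e = Min (insert 1 E)"
    have e: "e > 0" "\<And>x. x \<in> E \<Longrightarrow> e \<le> x" using E by (auto simp: e_def)
    have "\<exists>d\<in>{left_defect G \<mu> |\<mu>. fa_mean G \<mu>}. d < group_defect G + e"
      unfolding group_defect_def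
    proof (rule cInf_lessD)
      show "{left_defect G \<mu> |\<mu>. fa_mean G \<mu>} \<noteq> {}" using fa_mean_point_mass by auto
    qed (use e in simp)
    then obtain \<mu> where \<mu>: "fa_mean G \<mu>" "left_defect G \<mu> < group_defect G + e" by auto
    \<comment> \<open>\<open>\<mu>\<close> is arbitrary off the carrier, so it need not lie in the compact box.\<close>
    define \<nu> where "\<nu> = (\<lambda>A. \<mu> (A \<inter> carrier G))"
    have eq: "\<nu> A = \<mu> A" if "A \<subseteq> carrier G" for A
      using that by (simp add: \<nu>_def Int_absorb2)
    have "fa_mean G \<nu>" using \<mu>(1) eq by (simp add: fa_mean_def)
    moreover have "\<bar>\<nu> (g <# A) - \<nu> A\<bar> \<le> group_defect G + e" if "g \<in> carrier G" "A \<subseteq> carrier G" for g A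
      using left_defect_upper[OF \<mu>(1) that] \<mu>(2) eq[OF that(2)] eq[OF l_coset_subset_G[OF that(2,1)]]
      by linarith
    ultimately have "\<nu> \<in> K e" by (simp add: K_def)
    then have "\<nu> \<in> K x" if "x \<in> E" for x using K_mono[OF e(2)[OF that]] by blast
    moreover have "\<nu> \<in> ?B" using \<mu>(1) by (simp add: fa_mean_def \<nu>_def)
    ultimately have "\<nu> \<in> ?B \<inter> \<Inter> F" using E(3) by simp
    then show "?B \<inter> \<Inter> F \<noteq> {}" by blast
  qed
  then obtain \<mu> where \<mu>: "\<And>e. e > 0 \<Longrightarrow> \<mu> \<in> K e" by auto
  have mean: "fa_mean G \<mu>" using \<mu>[OF zero_less_one] by (simp add: K_def)
  have "left_defect G \<mu> \<le> group_defect G"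
  proof (rule left_defect_least, rule field_le_epsilon)
    fix g A and e :: real assume "g \<in> carrier G" "A \<subseteq> carrier G" "0 < e"
    then show "\<bar>\<mu> (g <# A) - \<mu> A\<bar> \<le> group_defect G + e" using \<mu>[of e] by (simp add: K_def)
  qed
  then show ?thesis using mean group_defect_le[OF mean] by (intro exI[of _ \<mu>]) auto
qed

end

section \<open>The dichotomy and amenability\<close>

theorem theorem1p7:
  fixes G :: "('a, 'b) monoid_scheme"
  assumes "group G"
  shows "(\<exists>\<mu>. fa_mean G \<mu> \<and> group_defect G = left_defect G \<mu>) \<and>
         (group_defect G = 0 \<or> group_defect G = 1) \<and>
         (group_defect G = 0 \<longleftrightarrow> amenable G)"
proof -
  interpret group G by fact
  obtain \<mu> where \<mu>: "fa_mean G \<mu>" "group_defect G = left_defect G \<mu>"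
    using group_defect_attained by blast
  have "group_defect G = 0" if "group_defect G \<noteq> 1"
  proof (rule antisym)
    \<comment> \<open>As the infimum is attained and is not 1, some mean has defect below 1, and
      \<open>small_left_defect\<close> then forces the infimum to 0.\<close>
    have "left_defect G \<mu> < 1" using that \<mu> left_defect_le_1 by force
    then have "group_defect G \<le> 0 + \<epsilon>" if "\<epsilon> > 0" for \<epsilon>
      using small_left_defect[OF \<mu>(1) _ that] group_defect_le by fastforce
    then show "group_defect G \<le> 0" by (rule field_le_epsilon)
  qed (use \<mu> left_defect_nonneg in simp)
  \<comment> \<open>A minimising mean of defect 0 is itself invariant, so attainment is essential to
    this argument.\<close>
  moreover have "amenable G" if "group_defect G = 0"
    unfolding amenable_def using \<mu> that left_defect_upper[OF \<mu>(1)] by (intro exI[of _ \<mu>]) fastforce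
  moreover have "group_defect G = 0" if amenable: "amenable G"
  proof -
    obtain \<nu> where \<nu>: "fa_mean G \<nu>" "\<forall>g\<in>carrier G. \<forall>A\<subseteq>carrier G. \<nu> (g <#\<^bsub>G\<^esub> A) = \<nu> A"
      using amenable unfolding amenable_def by blast
    have "left_defect G \<nu> \<le> 0" by (rule left_defect_least) (simp add: \<nu>(2))
    then show ?thesis using group_defect_le[OF \<nu>(1)] left_defect_nonneg[OF \<mu>(1)] \<mu>(2) by simp
  qed
  ultimately show ?thesis using \<mu> by blast
qed

end
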